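(* Let $c,d\in\mathbb{N}$ and let $G$ be a graph. Assume that there is a $d$-meager $(2cd,2c^2d)$-cluster in $G$. Then $G$ contains a $c$-hassle.
   Context: $G$ contains $H$ if $H$ is isomorphic to an induced subgraph of $G$. A path in $G$ is an induced subgraph that is a path. An $l$-polypath is a set of $l$ pairwise disjoint paths in $G$. An $(s,l)$-cluster in $G$ is a pair $(S,\mathcal{L})$ with $S\subseteq V(G)$, $|S|=s$, and $\mathcal{L}$ an $l$-polypath in $G\setminus S$ such that every vertex of $S$ has a neighbor in every path of $\mathcal{L}$; it is $d$-meager if every vertex in the union of the paths of $\mathcal{L}$ has fewer than $d$ neighbors in $S$. A walk is a graph $W$ with $n_W\in\mathbb{N}$ and a surjection $\varphi_W:\{1,\dots,n_W\}\to V(W)$ with $\varphi_W(i)\varphi_W(i+1)\in E(W)$ for $i<n_W$; first/last $c$ vertices are $\varphi_W(\{1,\dots,c\})$ and $\varphi_W(\{n_W-c+1,\dots,n_W\})$. $W$ is $c$-stretched if $W[\varphi_W(S)]$ is a path for every set $S\subseteq\{1,\dots,n_W\}$ of at most $c$ consecutive integers. A $c$-hassle is a graph obtained from at least $c$ pairwise disjoint $c$-stretched walks by adding arbitrary edges between different walks and then adding a vertex $x$ (neck) that has a neighbor in each walk and is non-adjacent to the first $c$ and last $c$ vertices of each walk. *)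

theory Defs
  imports "Graph_Theory.Digraph_Isomorphism"
begin

text \<open>
  Finite simple graphs are objects of the locale \<^locale>\<open>graph\<close>: finite symmetric digraphs without
  loops and parallel arcs, so adjacency of \<open>u\<close> and \<open>v\<close> is \<open>u \<rightarrow>\<^bsub>G\<^esub> v\<close>.
\<close>

definition contains_graph :: "('a, 'b) pre_digraph \<Rightarrow> ('c, 'd) pre_digraph \<Rightarrow> bool" where
  "contains_graph G H \<longleftrightarrow> (\<exists>H'. induced_subgraph H' G \<and> digraph_iso H H')"

text \<open>A path has at least one vertex; a single vertex is a path, the null graph is not.\<close>

definition path_graph :: "('a, 'b) pre_digraph \<Rightarrow> bool" where
  "path_graph P \<longleftrightarrow> graph P \<and>
    (\<exists>xs. xs \<noteq> [] \<and> distinct xs \<and> verts P = set xs \<and>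
      (\<forall>i < length xs. \<forall>j < length xs.
        xs ! i \<rightarrow>\<^bsub>P\<^esub> xs ! j \<longleftrightarrow> j = i + 1 \<or> i = j + 1))"

definition path_in :: "('a, 'b) pre_digraph \<Rightarrow> ('a, 'b) pre_digraph \<Rightarrow> bool" where
  "path_in G P \<longleftrightarrow> induced_subgraph P G \<and> path_graph P"

definition polypath :: "nat \<Rightarrow> ('a, 'b) pre_digraph \<Rightarrow> ('a, 'b) pre_digraph set \<Rightarrow> bool" where
  "polypath l G L \<longleftrightarrow> finite L \<and> card L = l \<and> (\<forall>P \<in> L. path_in G P) \<and>
    (\<forall>P \<in> L. \<forall>Q \<in> L. P \<noteq> Q \<longrightarrow> verts P \<inter> verts Q = {})"

definition cluster ::
  "nat \<Rightarrow> nat \<Rightarrow> ('a, 'b) pre_digraph \<Rightarrow> 'a set \<Rightarrow> ('a, 'b) pre_digraph set \<Rightarrow> bool" where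
  "cluster s l G S L \<longleftrightarrow> S \<subseteq> verts G \<and> finite S \<and> card S = s \<and>
    polypath l (G \<restriction> (verts G - S)) L \<and>
    (\<forall>x \<in> S. \<forall>P \<in> L. \<exists>v \<in> verts P. x \<rightarrow>\<^bsub>G\<^esub> v)"

definition meager ::
  "nat \<Rightarrow> ('a, 'b) pre_digraph \<Rightarrow> 'a set \<Rightarrow> ('a, 'b) pre_digraph set \<Rightarrow> bool" where
  "meager d G S L \<longleftrightarrow> (\<forall>v \<in> (\<Union>P \<in> L. verts P). card {x \<in> S. v \<rightarrow>\<^bsub>G\<^esub> x} < d)"

definition graph_walk :: "('a, 'b) pre_digraph \<Rightarrow> nat \<Rightarrow> (nat \<Rightarrow> 'a) \<Rightarrow> bool" where
  "graph_walk W n \<phi> \<longleftrightarrow> graph W \<and> 0 < n \<and> \<phi> ` {1..n} = verts W \<and>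
    (\<forall>i \<in> {1..<n}. \<phi> i \<rightarrow>\<^bsub>W\<^esub> \<phi> (i + 1))"

text \<open>
  If \<open>n < c\<close> then the first (last) \<open>c\<close> vertices of a walk are all its vertices; in
  \<open>last_vertices\<close> this is what the truncated subtraction gives.
\<close>

definition first_vertices :: "nat \<Rightarrow> nat \<Rightarrow> (nat \<Rightarrow> 'a) \<Rightarrow> 'a set" where
  "first_vertices c n \<phi> = \<phi> ` {1..min c n}"

definition last_vertices :: "nat \<Rightarrow> nat \<Rightarrow> (nat \<Rightarrow> 'a) \<Rightarrow> 'a set" where
  "last_vertices c n \<phi> = \<phi> ` {n - c + 1..n}"

definition stretched :: "nat \<Rightarrow> ('a, 'b) pre_digraph \<Rightarrow> nat \<Rightarrow> (nat \<Rightarrow> 'a) \<Rightarrow> bool" where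
  "stretched c W n \<phi> \<longleftrightarrow>
    (\<forall>a b. 1 \<le> a \<and> a \<le> b \<and> b \<le> n \<and> card {a..b} \<le> c \<longrightarrow> path_graph (W \<restriction> (\<phi> ` {a..b})))"

text \<open>
  \<open>W k\<close>, \<open>n k\<close>, \<open>\<phi> k\<close> for \<open>k < m\<close> are the walks and \<open>x\<close> is the neck. That each \<open>W k\<close> is an
  induced subgraph of \<open>H\<close> says that, apart from edges at \<open>x\<close>, only edges between different
  walks have been added.
\<close>

definition hassle :: "nat \<Rightarrow> ('a, 'b) pre_digraph \<Rightarrow> bool" where
  "hassle c H \<longleftrightarrow> graph H \<and>
    (\<exists>x m W n \<phi>. c \<le> m \<and>
      (\<forall>k < m. graph_walk (W k) (n k) (\<phi> k) \<and> stretched c (W k) (n k) (\<phi> k)) \<and>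
      (\<forall>j < m. \<forall>k < m. j \<noteq> k \<longrightarrow> verts (W j) \<inter> verts (W k) = {}) \<and>
      (\<forall>k < m. induced_subgraph (W k) H) \<and>
      x \<notin> (\<Union>k < m. verts (W k)) \<and>
      verts H = insert x (\<Union>k < m. verts (W k)) \<and>
      (\<forall>k < m. (\<exists>v \<in> verts (W k). x \<rightarrow>\<^bsub>H\<^esub> v) \<and>
        (\<forall>v \<in> first_vertices c (n k) (\<phi> k) \<union> last_vertices c (n k) (\<phi> k). \<not> x \<rightarrow>\<^bsub>H\<^esub> v)))"

end

theory Submission
  imports Defs
begin

text \<open>
  In each path of the cluster, the first and last \<open>c\<close> vertices have together fewer than \<open>2cd\<close>
  neighbours in \<open>S\<close>, so some vertex of \<open>S\<close> is non-adjacent to all of them. With \<open>2c\<^sup>2d\<close> paths and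
  \<open>2cd\<close> vertices in \<open>S\<close>, one vertex \<open>x\<close> serves \<open>c\<close> paths; these paths, with \<open>x\<close> as neck, induce
  a \<open>c\<close>-hassle.
\<close>

lemma dominates_induce_subgraph_iff:
  "u \<rightarrow>\<^bsub>G \<restriction> V\<^esub> v \<longleftrightarrow> u \<rightarrow>\<^bsub>G\<^esub> v \<and> u \<in> V \<and> v \<in> V"
  by (auto simp: arcs_ends_def arc_to_ends_def)

lemma graph_induce_subgraph:
  assumes "graph G" "V \<subseteq> verts G"
  shows "graph (G \<restriction> V)"
proof -
  interpret graph G by fact
  note ind = induced_induce[OF assms(2)]
  interpret H: digraph "G \<restriction> V" using ind by (rule digraphI_induced)
  interpret H: sym_digraph "G \<restriction> V" using ind by (rule induced_graph_imp_graph)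
  show ?thesis by unfold_locales
qed

text \<open>The arcs of \<open>P\<close> are exactly the arcs of \<open>G\<close> with both ends in
  \<open>verts P\<close>, whichever set of vertices around \<open>P\<close> is kept. This is needed
  because the paths of a cluster are induced in \<open>G\<close> minus \<open>S\<close>, whereas the
  hassle also contains a vertex of \<open>S\<close>, its neck.\<close>

lemma induced_subgraph_induce_subgraph:
  assumes "induced_subgraph P (G \<restriction> U)" "wf_digraph G" "verts P \<subseteq> V"
  shows "induced_subgraph P (G \<restriction> V)"
  using assms wf_digraph.wellformed_induce_subgraph[OF assms(2), of V]
  by (auto simp: induced_subgraph_def subgraph_def compatible_def)

lemma digraph_iso_refl:
  assumes "wf_digraph G"
  shows "digraph_iso G G"
  unfolding digraph_iso_def
  \<comment> \<open>An isomorphism record also carries the incidence functions of the image, so the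
    identity has to keep those of \<open>G\<close>.\<close>
  by (rule exI[of _ "\<lparr>iso_verts = id, iso_arcs = id, iso_head = head G, iso_tail = tail G\<rparr>"])
    (use assms in \<open>auto simp: pre_digraph.digraph_isomorphism_def app_iso_def\<close>)

lemma contains_graph_induce_subgraph:
  assumes "wf_digraph G" "V \<subseteq> verts G"
  shows "contains_graph G (G \<restriction> V)"
  unfolding contains_graph_def
  using wf_digraph.induced_induce[OF assms]
    digraph_iso_refl[OF wf_digraph.wellformed_induce_subgraph[OF assms(1)]] by blast

text \<open>Traverse the path once from end to end. Consecutive indices then span a segment of the
  path, which is a path whatever its length, so one walk works for all \<open>c\<close>.\<close>

lemma path_graph_walk_stretched:
  assumes "path_graph P"
  obtains n \<phi> where "graph_walk P n \<phi>" "\<And>c. stretched c P n \<phi>"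
proof -
  from assms obtain xs where P: "graph P" and xs: "xs \<noteq> []" "distinct xs" "verts P = set xs"
    and adj: "\<And>i j. i < length xs \<Longrightarrow> j < length xs \<Longrightarrow>
        xs ! i \<rightarrow>\<^bsub>P\<^esub> xs ! j \<longleftrightarrow> j = i + 1 \<or> i = j + 1"
    unfolding path_graph_def by blast
  \<comment> \<open>Walks are indexed from 1, lists from 0.\<close>
  define \<phi> where "\<phi> i = xs ! (i - 1)" for i
  have img: "\<phi> ` {a..b} = set (take (b + 1 - a) (drop (a - 1) xs))"
    if "1 \<le> a" "b \<le> length xs" for a b
  proof (intro equalityI subsetI)
    fix v assume "v \<in> \<phi> ` {a..b}"
    then obtain i where "a \<le> i" "i \<le> b" "v = xs ! (i - 1)" by (auto simp: \<phi>_def)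
    then show "v \<in> set (take (b + 1 - a) (drop (a - 1) xs))"
      using that by (auto simp: in_set_conv_nth intro!: exI[of _ "i - a"])
  next
    fix v assume "v \<in> set (take (b + 1 - a) (drop (a - 1) xs))"
    then obtain i where "i < b + 1 - a" "v = xs ! (a - 1 + i)"
      using that by (auto simp: in_set_conv_nth)
    then show "v \<in> \<phi> ` {a..b}"
      using that by (auto simp: \<phi>_def intro!: image_eqI[of _ _ "a + i"])
  qed
  have walk: "graph_walk P (length xs) \<phi>"
    unfolding graph_walk_def
    using P xs img[of 1 "length xs"] by (auto simp: \<phi>_def adj)
  have "stretched c P (length xs) \<phi>" for c
    unfolding stretched_def
  proof (intro allI impI)
    fix a b assume ab: "1 \<le> a \<and> a \<le> b \<and> b \<le> length xs \<and> card {a..b} \<le> c"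
    define ys where "ys = take (b + 1 - a) (drop (a - 1) xs)"
    have ys: "\<phi> ` {a..b} = set ys" "length ys = b + 1 - a" "distinct ys"
      using img[of a b] ab xs by (auto simp: ys_def)
    have nth: "ys ! i = xs ! (a - 1 + i)" if "i < length ys" for i
      using that ab unfolding ys_def by (subst nth_take, simp, subst nth_drop) auto
    have "set ys \<subseteq> verts P"
      using xs by (auto simp: ys_def dest: in_set_takeD in_set_dropD)
    then have "graph (P \<restriction> set ys)" by (rule graph_induce_subgraph[OF P])
    moreover have "ys ! i \<rightarrow>\<^bsub>P \<restriction> set ys\<^esub> ys ! j \<longleftrightarrow> j = i + 1 \<or> i = j + 1"
      if "i < length ys" "j < length ys" for i j
    proof -
      have "ys ! i \<rightarrow>\<^bsub>P \<restriction> set ys\<^esub> ys ! j \<longleftrightarrow> xs ! (a - 1 + i) \<rightarrow>\<^bsub>P\<^esub> xs ! (a - 1 + j)"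
        using that by (simp only: dominates_induce_subgraph_iff nth_mem simp_thms flip: nth)
      \<comment> \<open>Both positions are shifted by the same offset \<open>a - 1\<close>, so being
        consecutive in \<open>ys\<close> and in \<open>xs\<close> is the same.\<close>
      also have "\<dots> \<longleftrightarrow> j = i + 1 \<or> i = j + 1"
        using that ab ys by (subst adj) auto
      finally show ?thesis .
    qed
    ultimately show "path_graph (P \<restriction> (\<phi> ` {a..b}))"
      unfolding path_graph_def ys(1) using ys ab by (intro conjI exI[of _ ys]) auto
  qed
  with walk show thesis by (rule that)
qed

text \<open>A union bound: each vertex of \<open>A\<close> rules out at most \<open>d - 1\<close>
  elements of \<open>S\<close>, too few in total to exhaust \<open>S\<close>.\<close>

lemma exists_non_neighbour:
  assumes "finite A" "A \<subseteq> V" "finite S" "card A * (d - 1) < card S"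
    and "\<And>v. v \<in> V \<Longrightarrow> card {x \<in> S. R v x} < d"
  obtains x where "x \<in> S" "\<And>v. v \<in> A \<Longrightarrow> \<not> R v x"
proof -
  have "card (\<Union>v\<in>A. {x \<in> S. R v x}) \<le> (\<Sum>v\<in>A. card {x \<in> S. R v x})"
    by (rule card_UN_le) fact
  also have "\<dots> \<le> (\<Sum>v\<in>A. d - 1)"
    using assms(2,5) by (intro sum_mono) fastforce
  also have "\<dots> < card S" using assms(4) by simp
  finally have "(\<Union>v\<in>A. {x \<in> S. R v x}) \<noteq> S" by auto
  then show thesis using that by blast
qed

text \<open>Pigeonhole: the fibres over \<open>B\<close> partition \<open>A\<close>, so they cannot
  all have fewer than \<open>c\<close> elements.\<close>

lemma exists_large_fibre:
  assumes "finite A" "finite B" "f ` A \<subseteq> B" "B \<noteq> {}" "card B * c \<le> card A"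
  obtains y where "y \<in> B" "c \<le> card {x \<in> A. f x = y}"
proof (rule ccontr)
  assume "\<not> thesis"
  then have small: "card {x \<in> A. f x = y} < c" if "y \<in> B" for y
    using \<open>\<And>y. y \<in> B \<Longrightarrow> c \<le> card {x \<in> A. f x = y} \<Longrightarrow> thesis\<close> that not_le by blast
  have "card A = (\<Sum>y\<in>B. card {x \<in> A. f x = y})"
    using sum.group[OF assms(1-3), of "\<lambda>_. 1 :: nat"] by simp
  \<comment> \<open>Strict because \<open>B\<close> is nonempty.\<close>
  also have "\<dots> < (\<Sum>y\<in>B. c)"
    using assms small by (intro sum_strict_mono) auto
  also have "\<dots> \<le> card A" using assms(5) by simp
  finally show False by simp
qed

theorem theorem6p2:
  fixes G :: "('a, 'b) pre_digraph" and c d :: nat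
  assumes "0 < c" and "0 < d"
    and "graph G"
    and "\<exists>S L. cluster (2 * c * d) (2 * c\<^sup>2 * d) G S L \<and> meager d G S L"
  shows "\<exists>H :: ('a, 'b) pre_digraph. hassle c H \<and> contains_graph G H"
proof -
  interpret graph G by fact
  obtain S L where cl: "cluster (2 * c * d) (2 * c\<^sup>2 * d) G S L" and me: "meager d G S L"
    using assms(4) by blast
  have SG: "S \<subseteq> verts G" and S: "finite S" "card S = 2 * c * d"
    and poly: "polypath (2 * c\<^sup>2 * d) (G \<restriction> (verts G - S)) L"
    and nbr: "\<And>x P. x \<in> S \<Longrightarrow> P \<in> L \<Longrightarrow> \<exists>v \<in> verts P. x \<rightarrow>\<^bsub>G\<^esub> v"
    using cl unfolding cluster_def by simp_all
  have L: "finite L" "card L = 2 * c\<^sup>2 * d"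
    and path: "\<And>P. P \<in> L \<Longrightarrow> path_in (G \<restriction> (verts G - S)) P"
    and disj: "\<And>P Q. P \<in> L \<Longrightarrow> Q \<in> L \<Longrightarrow> P \<noteq> Q \<Longrightarrow> verts P \<inter> verts Q = {}"
    using poly unfolding polypath_def by simp_all
  have few: "card {x \<in> S. v \<rightarrow>\<^bsub>G\<^esub> x} < d" if "P \<in> L" "v \<in> verts P" for v P
    using me that unfolding meager_def by blast
  have ind: "induced_subgraph P (G \<restriction> (verts G - S))" and pathP: "path_graph P" if "P \<in> L" for P
    using path[OF that] by (auto simp: path_in_def)
  have vertsP: "verts P \<subseteq> verts G - S" if "P \<in> L" for P
    using ind[OF that] by (auto simp: induced_subgraph_def subgraph_def)
  have "\<exists>n \<phi>. graph_walk P n \<phi> \<and> stretched c P n \<phi>" if "P \<in> L" for P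
    using path_graph_walk_stretched[OF pathP[OF that]] by metis
  then obtain n \<phi> where walk: "\<And>P. P \<in> L \<Longrightarrow> graph_walk P (n P) (\<phi> P)"
    and stretch: "\<And>P. P \<in> L \<Longrightarrow> stretched c P (n P) (\<phi> P)" by metis
  \<comment> \<open>The vertices of \<open>P\<close> that the neck must avoid.\<close>
  define E where "E P = first_vertices c (n P) (\<phi> P) \<union> last_vertices c (n P) (\<phi> P)" for P
  have "\<exists>x \<in> S. \<forall>v \<in> E P. \<not> v \<rightarrow>\<^bsub>G\<^esub> x" if "P \<in> L" for P
  proof -
    have "card (first_vertices c (n P) (\<phi> P)) \<le> c"
      unfolding first_vertices_def by (rule order.trans[OF card_image_le]) auto
    moreover have "card (last_vertices c (n P) (\<phi> P)) \<le> c"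
      unfolding last_vertices_def by (rule order.trans[OF card_image_le]) auto
    ultimately have "card (E P) \<le> 2 * c"
      unfolding E_def by (intro order.trans[OF card_Un_le]) simp
    then have "card (E P) * (d - 1) \<le> 2 * c * (d - 1)" by simp
    \<comment> \<open>This is where the size \<open>2 * c * d\<close> of \<open>S\<close> is used:
      it exceeds \<open>2 * c * (d - 1)\<close> since \<open>c\<close> and \<open>d\<close> are
      positive.\<close>
    also have "\<dots> < card S" using S assms(1,2) by simp
    finally have "card (E P) * (d - 1) < card S" .
    \<comment> \<open>This includes the case \<open>n P < c\<close>: \<open>min\<close> and
      truncated subtraction keep all indices within \<open>{1..n P}\<close>.\<close>
    moreover have "E P \<subseteq> verts P"
      using walk[OF that] unfolding graph_walk_def E_def first_vertices_def last_vertices_def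
      by force
    moreover have "finite (E P)"
      by (simp add: E_def first_vertices_def last_vertices_def)
    ultimately show ?thesis
      using exists_non_neighbour[of "E P" "verts P" S d "\<lambda>v x. v \<rightarrow>\<^bsub>G\<^esub> x"] S(1) few[OF that]
      by metis
  qed
  then obtain f where f: "\<And>P. P \<in> L \<Longrightarrow> f P \<in> S"
    and free: "\<And>P v. P \<in> L \<Longrightarrow> v \<in> E P \<Longrightarrow> \<not> v \<rightarrow>\<^bsub>G\<^esub> f P" by metis
  have "S \<noteq> {}" using S assms(1,2) by auto
  \<comment> \<open>The numbers match exactly: \<open>card S * c\<close> is
    \<open>2 * c * d * c\<close>, which is \<open>card L\<close>.\<close>
  then obtain x where x: "x \<in> S" and large: "c \<le> card {P \<in> L. f P = x}"
    using exists_large_fibre[of L S f c] L S f by (auto simp: power2_eq_square ac_simps)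
  define M where "M = {P \<in> L. f P = x}"
  have "finite M" using L by (simp add: M_def)
  \<comment> \<open>A hassle takes its walks as an indexed family. Injectivity of the enumeration
    turns distinct indices into distinct, hence disjoint, paths.\<close>
  then obtain W where W: "bij_betw W {..<card M} M"
    using ex_bij_betw_nat_finite by (metis atLeast0LessThan)
  have WL: "W k \<in> L" and fW: "f (W k) = x" if "k < card M" for k
    using bij_betwE[OF W] that by (auto simp: M_def)
  define V where "V = insert x (\<Union>k<card M. verts (W k))"
  have VG: "V \<subseteq> verts G" using x SG WL vertsP by (fastforce simp: V_def)
  \<comment> \<open>Edges of \<open>G\<close> between different chosen paths stay in this subgraph;
    a hassle allows any such edges.\<close>
  have "hassle c (G \<restriction> V)"
    unfolding hassle_def
  proof (intro conjI exI[of _ x] exI[of _ "card M"] exI[of _ W] exI[of _ "\<lambda>k. n (W k)"]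
      exI[of _ "\<lambda>k. \<phi> (W k)"] allI impI)
    show "graph (G \<restriction> V)" by (rule graph_induce_subgraph[OF assms(3) VG])
    show "c \<le> card M" using large by (simp add: M_def)
    show "x \<notin> (\<Union>k<card M. verts (W k))" using x WL vertsP by blast
    show "verts (G \<restriction> V) = insert x (\<Union>k<card M. verts (W k))" by (simp add: V_def)
  next
    fix j k assume "j < card M" "k < card M" "j \<noteq> k"
    then show "verts (W j) \<inter> verts (W k) = {}"
      using W WL disj by (metis bij_betw_def inj_on_def lessThan_iff)
  next
    fix k assume k: "k < card M"
    note kL = WL[OF k]
    show "graph_walk (W k) (n (W k)) (\<phi> (W k))" by (rule walk[OF kL])
    show "stretched c (W k) (n (W k)) (\<phi> (W k))" by (rule stretch[OF kL])
    have sub: "verts (W k) \<subseteq> V" using k by (auto simp: V_def)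
    then show "induced_subgraph (W k) (G \<restriction> V)"
      using induced_subgraph_induce_subgraph[OF ind[OF kL]] wf_digraph_axioms by blast
    show "\<exists>v \<in> verts (W k). x \<rightarrow>\<^bsub>G \<restriction> V\<^esub> v"
      using nbr[OF x kL] sub by (auto simp: dominates_induce_subgraph_iff V_def)
    \<comment> \<open>Meagerness counts arcs from the path into \<open>S\<close>, so
      \<open>free\<close> speaks of arcs towards the neck; symmetry of \<open>G\<close> reverses
      them.\<close>
    show "\<forall>v \<in> first_vertices c (n (W k)) (\<phi> (W k)) \<union> last_vertices c (n (W k)) (\<phi> (W k)).
        \<not> x \<rightarrow>\<^bsub>G \<restriction> V\<^esub> v"
      using free[OF kL] fW[OF k] graph_symmetric
      unfolding E_def dominates_induce_subgraph_iff by metis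
  qed
  moreover have "contains_graph G (G \<restriction> V)"
    by (rule contains_graph_induce_subgraph[OF wf_digraph_axioms VG])
  ultimately show ?thesis by blast
qed

end
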